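(* Let $\sigma_{\mathcal{P}}:=\|\mathcal{P}^{-1}\mathcal{A}\|_2$, let $\mathcal{T}$ be a truncation operator of accuracy $\epsilon>0$, and let $\|\mathcal{E}_{\hat r_i}\|_2\le\epsilon\|\mathcal{P}^{-1}\|_2$ for all $i\ge 0$. Let $x_l$ and $\hat x_l$ be the $l$th iterates of the standard Chebyshev method and of the ChebyshevT method, and put $e_l:=\|\hat x_l-x_l\|_2$. Then $$e_1\le\epsilon\Big(1+\frac{1}{|d|}\|\mathcal{P}^{-1}\|_2\Big),$$ $$e_2\le\epsilon\Big(3+|\alpha_1|\sigma_{\mathcal{P}}+\Big(|\alpha_1|+\frac{1+|\beta_1|+|\alpha_1|\sigma_{\mathcal{P}}}{|d|}\Big)\|\mathcal{P}^{-1}\|_2\Big),$$ and for $l\ge3$ $$e_l\le\big(1+|\alpha_{l-1}|\sigma_{\mathcal{P}}\big)e_{l-1}+\sum_{j=1}^{l-2}|\alpha_j|\,e_j\,\sigma_{\mathcal{P}}\prod_{i=1}^{l-j-1}|\beta_{i+j}|+\epsilon\Bigg(2+\sum_{j=1}^{l-2}\prod_{i=1}^{l-j-1}|\beta_{i+j}|+\Big(\sum_{j=1}^{l-1}|\alpha_j|\prod_{i=1}^{l-j-1}|\beta_{i+j}|+\frac{\prod_{j=1}^{l-1}|\beta_j|}{|d|}\Big)\|\mathcal{P}^{-1}\|_2\Bigg),$$ where empty products equal $1$.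
   Context: Let $M,m,R\in\mathbb{N}$. The matrix $\mathcal{A}\in\mathbb{R}^{Mm\times Mm}$ is $\mathcal{A}=I_m\otimes A_0+D_1\otimes A_1+D_2\otimes A_2+\nu_f D_3\otimes A_3$ with $A_0,\dots,A_3\in\mathbb{R}^{M\times M}$, diagonal $D_1,D_2,D_3\in\mathbb{R}^{m\times m}$ and $\nu_f\in\mathbb{R}$; its diagonal blocks are assumed invertible. $\mathcal{P}=I_m\otimes P$ with $P\in\mathbb{R}^{M\times M}$ invertible is the preconditioner. $b\in\mathbb{R}^{Mm}$ is the right-hand side, $x_0\in\mathbb{R}^{Mm}$ the start vector. Identify $\mathbb{R}^{Mm}$ with $\mathbb{R}^{M\times m}$ by stacking columns. $T_R\subset\mathbb{R}^{Mm}$ is the set of (vectorized) $M\times m$ matrices of rank at most $R$. A truncation operator is a map $\mathcal{T}:\mathbb{R}^{Mm}\to T_R$ (for tensors of order 2 it is based on the singular value decomposition and projects its argument to $T_R$). It is said to have accuracy $\epsilon>0$ if for any $x\in\mathbb{R}^{Mm}$ one has $\mathcal{T}(x)=x+\mathcal{E}$ with $\|\mathcal{E}\|_2\le\epsilon$. Exact arithmetic is assumed. Start vector and right-hand side are of low rank: $\hat x_0=\mathcal{T}(x_0)=x_0$, $\hat b=\mathcal{T}(b)=b$. Parameters: real numbers $0<c<d$ (center $d$ and foci $d\pm c$ of an ellipse not touching the imaginary axis). Put $t_0:=1$, $t_1:=d/c$, and for $i\ge1$: $t_{i+1}:=2\frac{d}{c}t_i-t_{i-1}$, $\alpha_i:=\frac{2t_i}{c\,t_{i+1}}$,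 $\beta_i:=\frac{t_{i-1}}{t_{i+1}}$. Standard Chebyshev method: $r_i:=\mathcal{P}^{-1}(b-\mathcal{A}x_i)$ for $i\ge0$; $\Phi_0:=\frac1d r_0$, $\Phi_i:=\alpha_ir_i+\beta_i\Phi_{i-1}$ for $i\ge1$; $x_{i+1}:=x_i+\Phi_i$ for $i\ge0$. ChebyshevT method (truncated Chebyshev): for $i\ge0$, $\hat r_i$ is the computed preconditioned residual, $\hat r_i=\mathcal{P}^{-1}(b-\mathcal{A}\hat x_i)+\mathcal{E}_{\hat r_i}$, obtained by solving $\mathcal{P}\hat r_i=\mathcal{T}(b-\mathcal{A}\hat x_i)$, so that $\|\mathcal{E}_{\hat r_i}\|_2\le\epsilon\|\mathcal{P}^{-1}\|_2$; $\hat\Phi_0:=\frac1d\hat r_0$, $\hat\Phi_i:=\mathcal{T}(\alpha_i\hat r_i+\beta_i\hat\Phi_{i-1})$ for $i\ge1$; $\hat x_{i+1}:=\mathcal{T}(\hat x_i+\hat\Phi_i)$ for $i\ge0$. *)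

theory Defs
  imports "HOL-Analysis.Analysis"
begin

(* The index type 'm \<times> 'M, read lexicographically, is the index set {1..Mm} of the stacked
   columns of an M \<times> m matrix: component (j, i) is row i of column j, and 'm numbers the
   blocks of A \<otimes> B for an m \<times> m matrix A and an M \<times> M matrix B. *)

definition kron :: "real ^ 'q ^ 'p \<Rightarrow> real ^ 'n ^ 'k \<Rightarrow> real ^ ('q \<times> 'n) ^ ('p \<times> 'k)"
    (infixl "\<otimes>\<^sub>K" 75) where
  "A \<otimes>\<^sub>K B = (\<chi> r s. A $ fst r $ fst s * B $ snd r $ snd s)"

definition diagonal_matrix :: "real ^ 'n ^ 'n \<Rightarrow> bool" where
  "diagonal_matrix D \<longleftrightarrow> (\<forall>i j. i \<noteq> j \<longrightarrow> D $ i $ j = 0)"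

definition diagonal_block :: "real ^ ('m::finite \<times> 'n::finite) ^ ('m \<times> 'n)
    \<Rightarrow> 'm \<Rightarrow> real ^ 'n ^ 'n" where
  "diagonal_block A j = (\<chi> i k. A $ (j, i) $ (j, k))"

(* Needed because norm on the matrix type real ^ 'n ^ 'k is the Frobenius norm. *)
definition spectral_norm :: "real ^ 'n ^ 'k \<Rightarrow> real" where
  "spectral_norm A = onorm (\<lambda>x. A *v x)"

definition unstack :: "real ^ ('m::finite \<times> 'n::finite) \<Rightarrow> real ^ 'm ^ 'n" where
  "unstack x = (\<chi> i j. x $ (j, i))"

definition low_rank :: "nat \<Rightarrow> (real ^ ('m::finite \<times> 'n::finite)) set" where
  "low_rank R = {x. rank (unstack x) \<le> R}"

definition truncation_operator ::
    "nat \<Rightarrow> (real ^ ('m::finite \<times> 'n::finite) \<Rightarrow> real ^ ('m \<times> 'n)) \<Rightarrow> bool" where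
  "truncation_operator R T \<longleftrightarrow> T \<in> UNIV \<rightarrow> low_rank R"

definition has_accuracy :: "(real ^ 'n \<Rightarrow> real ^ 'n) \<Rightarrow> real \<Rightarrow> bool" where
  "has_accuracy T \<epsilon> \<longleftrightarrow> (\<forall>x. \<exists>E. T x = x + E \<and> norm E \<le> \<epsilon>)"

fun cheb_t :: "real \<Rightarrow> real \<Rightarrow> nat \<Rightarrow> real" where
  "cheb_t c d 0 = 1"
| "cheb_t c d (Suc 0) = d / c"
| "cheb_t c d (Suc (Suc i)) = 2 * (d / c) * cheb_t c d (Suc i) - cheb_t c d i"

(* cheb_alpha and cheb_beta are only meaningful for indices i \<ge> 1. *)
definition cheb_alpha :: "real \<Rightarrow> real \<Rightarrow> nat \<Rightarrow> real" where
  "cheb_alpha c d i = 2 * cheb_t c d i / (c * cheb_t c d (i + 1))"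

definition cheb_beta :: "real \<Rightarrow> real \<Rightarrow> nat \<Rightarrow> real" where
  "cheb_beta c d i = cheb_t c d (i - 1) / cheb_t c d (i + 1)"

(* Each method is the relation that holds of exactly the sequences it generates. *)

definition chebyshev_method ::
    "real ^ 'n ^ 'n \<Rightarrow> real ^ 'n ^ 'n \<Rightarrow> real ^ 'n \<Rightarrow> real ^ 'n \<Rightarrow> real \<Rightarrow> real \<Rightarrow>
     (nat \<Rightarrow> real ^ 'n) \<Rightarrow> (nat \<Rightarrow> real ^ 'n) \<Rightarrow> (nat \<Rightarrow> real ^ 'n) \<Rightarrow> bool" where
  "chebyshev_method A P b x0 c d r \<Phi> x \<longleftrightarrow>
     x 0 = x0 \<and>
     (\<forall>i. r i = matrix_inv P *v (b - A *v x i)) \<and>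
     \<Phi> 0 = (1 / d) *\<^sub>R r 0 \<and>
     (\<forall>i\<ge>1. \<Phi> i = cheb_alpha c d i *\<^sub>R r i + cheb_beta c d i *\<^sub>R \<Phi> (i - 1)) \<and>
     (\<forall>i. x (i + 1) = x i + \<Phi> i)"

definition chebyshevT_method ::
    "(real ^ 'n \<Rightarrow> real ^ 'n) \<Rightarrow>
     real ^ 'n ^ 'n \<Rightarrow> real ^ 'n ^ 'n \<Rightarrow> real ^ 'n \<Rightarrow> real ^ 'n \<Rightarrow> real \<Rightarrow> real \<Rightarrow>
     (nat \<Rightarrow> real ^ 'n) \<Rightarrow> (nat \<Rightarrow> real ^ 'n) \<Rightarrow> (nat \<Rightarrow> real ^ 'n) \<Rightarrow> bool" where
  "chebyshevT_method T A P b x0 c d r \<Phi> x \<longleftrightarrow>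
     x 0 = T x0 \<and>
     (\<forall>i. P *v r i = T (b - A *v x i)) \<and>
     \<Phi> 0 = (1 / d) *\<^sub>R r 0 \<and>
     (\<forall>i\<ge>1. \<Phi> i = T (cheb_alpha c d i *\<^sub>R r i + cheb_beta c d i *\<^sub>R \<Phi> (i - 1))) \<and>
     (\<forall>i. x (i + 1) = T (x i + \<Phi> i))"

end

theory Submission
  imports Defs
begin

text \<open>
  Truncation perturbs each iterate and each update by at most \<open>\<epsilon>\<close>, and both methods are affine with
  the same coefficients. Hence the update error \<open>f\<^sub>i = \<parallel>\<Phi>h\<^sub>i - \<Phi>\<^sub>i\<parallel>\<close> obeys the linear recursive
  inequality \<open>f\<^sub>i \<le> \<epsilon> + |\<alpha>\<^sub>i| (\<sigma> e\<^sub>i + \<epsilon> N) + |\<beta>\<^sub>i| f\<^sub>i\<^sub>-\<^sub>1\<close> with \<open>N = \<parallel>\<P>\<^sup>-\<^sup>1\<parallel>\<close> and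
  \<open>f\<^sub>0 \<le> \<epsilon> N / d\<close>, while \<open>e\<^sub>i\<^sub>+\<^sub>1 \<le> e\<^sub>i + f\<^sub>i + \<epsilon>\<close>. Unrolling the recursion for \<open>f\<close> gives the bounds.
\<close>

lemma norm_matrix_vector_mult_le_spectral_norm:
  fixes A :: "real ^ 'n ^ 'k"
  shows "norm (A *v x) \<le> spectral_norm A * norm x"
  unfolding spectral_norm_def by (rule onorm) (rule matrix_vector_mul_bounded_linear)

text \<open>The triangle inequality charges each truncation a single additive \<epsilon>, whatever
  the comparison point \<open>y\<close>. Below, \<open>y\<close> is an exact iterate or update,
  which need not have low rank.\<close>

lemma has_accuracy_norm_diff_le:
  assumes "has_accuracy T \<epsilon>"
  shows "norm (T x - y) \<le> norm (x - y) + \<epsilon>"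
proof -
  obtain E where "T x = x + E" "norm E \<le> \<epsilon>"
    using assms unfolding has_accuracy_def by blast
  moreover have "norm (x + E - y) \<le> norm (x - y) + norm E"
    using norm_triangle_ineq[of "x - y" E] by (simp add: algebra_simps)
  ultimately show ?thesis by simp
qed

text \<open>A discrete variation-of-constants bound: the source \<open>u j\<close> enters at step
  \<open>j\<close> and is then amplified by \<open>b (j+1)\<close>, ..., \<open>b n\<close>.
  Nonnegativity of \<open>b\<close> lets the induction hypothesis be multiplied by the next
  coefficient.\<close>

lemma linear_recurrence_le:
  fixes f u b :: "nat \<Rightarrow> real"
  assumes step: "\<And>n. f (Suc n) \<le> u (Suc n) + b (Suc n) * f n"
    and nonneg: "\<And>n. 0 \<le> b n"
  shows "f n \<le> (\<Sum>j=1..n. u j * (\<Prod>i=1..n-j. b (i + j))) + (\<Prod>j=1..n. b j) * f 0"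
proof (induction n)
  case 0
  show ?case by simp
next
  case (Suc n)
  \<comment> \<open>For \<open>j\<close> at most \<open>n\<close>, natural subtraction gives
    \<open>Suc n - j = Suc (n - j)\<close>, so exactly one factor is added, with index
    \<open>Suc n\<close>.\<close>
  have prod_Suc: "(\<Prod>i=1..Suc n-j. b (i + j)) = b (Suc n) * (\<Prod>i=1..n-j. b (i + j))"
    if "j \<in> {1..n}" for j
    using that by (simp add: Suc_diff_le)
  have "f (Suc n) \<le> u (Suc n) + b (Suc n) *
      ((\<Sum>j=1..n. u j * (\<Prod>i=1..n-j. b (i + j))) + (\<Prod>j=1..n. b j) * f 0)"
    using step[of n] mult_left_mono[OF Suc.IH nonneg[of "Suc n"]] by linarith
  also have "\<dots> = u (Suc n) + (\<Sum>j=1..n. u j * (b (Suc n) * (\<Prod>i=1..n-j. b (i + j))))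
      + (\<Prod>j=1..Suc n. b j) * f 0"
    by (simp add: sum_distrib_left algebra_simps)
  also have "\<dots> = (\<Sum>j=1..Suc n. u j * (\<Prod>i=1..Suc n-j. b (i + j)))
      + (\<Prod>j=1..Suc n. b j) * f 0"
    using prod_Suc by simp
  finally show ?case .
qed

theorem theorem6p10:
  fixes A0 A1 A2 A3 P :: "real ^ 'M ^ 'M"
    and D1 D2 D3 :: "real ^ 'm ^ 'm"
    and \<nu>f c d \<epsilon> \<sigma> :: real
    and R :: nat
    and \<A> \<P> :: "real ^ ('m \<times> 'M) ^ ('m \<times> 'M)"
    and b x0 :: "real ^ ('m \<times> 'M)"
    and T :: "real ^ ('m \<times> 'M) \<Rightarrow> real ^ ('m \<times> 'M)"
    and r \<Phi> x rh \<Phi>h xh Er :: "nat \<Rightarrow> real ^ ('m \<times> 'M)"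
    and \<alpha> \<beta> e :: "nat \<Rightarrow> real"
  assumes A_def: "\<A> = mat 1 \<otimes>\<^sub>K A0 + D1 \<otimes>\<^sub>K A1 + D2 \<otimes>\<^sub>K A2 + \<nu>f *\<^sub>R (D3 \<otimes>\<^sub>K A3)"
    and diag: "diagonal_matrix D1" "diagonal_matrix D2" "diagonal_matrix D3"
    and blocks: "\<And>j. invertible (diagonal_block \<A> j)"
    and P_inv: "invertible P"
    and P_def: "\<P> = mat 1 \<otimes>\<^sub>K P"
    and cd: "0 < c" "c < d"
    and \<alpha>_def: "\<alpha> = cheb_alpha c d"
    and \<beta>_def: "\<beta> = cheb_beta c d"
    and eps: "\<epsilon> > 0"
    and trunc: "truncation_operator R T"
    and acc: "has_accuracy T \<epsilon>"
    and low: "T x0 = x0" "T b = b"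
    and std: "chebyshev_method \<A> \<P> b x0 c d r \<Phi> x"
    and chebT: "chebyshevT_method T \<A> \<P> b x0 c d rh \<Phi>h xh"
    and res: "\<And>i. rh i = matrix_inv \<P> *v (b - \<A> *v xh i) + Er i"
    and res_err: "\<And>i. norm (Er i) \<le> \<epsilon> * spectral_norm (matrix_inv \<P>)"
    and \<sigma>_def: "\<sigma> = spectral_norm (matrix_inv \<P> ** \<A>)"
    and e_def: "\<And>l. e l = norm (xh l - x l)"
  shows "e 1 \<le> \<epsilon> * (1 + 1 / \<bar>d\<bar> * spectral_norm (matrix_inv \<P>)) \<and>
         e 2 \<le> \<epsilon> * (3 + \<bar>\<alpha> 1\<bar> * \<sigma>
           + (\<bar>\<alpha> 1\<bar> + (1 + \<bar>\<beta> 1\<bar> + \<bar>\<alpha> 1\<bar> * \<sigma>) / \<bar>d\<bar>) * spectral_norm (matrix_inv \<P>)) \<and>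
         (\<forall>l\<ge>3.
           e l \<le> (1 + \<bar>\<alpha> (l - 1)\<bar> * \<sigma>) * e (l - 1)
             + (\<Sum>j=1..l-2. \<bar>\<alpha> j\<bar> * e j * \<sigma> * (\<Prod>i=1..l-j-1. \<bar>\<beta> (i + j)\<bar>))
             + \<epsilon> * (2 + (\<Sum>j=1..l-2. \<Prod>i=1..l-j-1. \<bar>\<beta> (i + j)\<bar>)
                 + ((\<Sum>j=1..l-1. \<bar>\<alpha> j\<bar> * (\<Prod>i=1..l-j-1. \<bar>\<beta> (i + j)\<bar>))
                    + (\<Prod>j=1..l-1. \<bar>\<beta> j\<bar>) / \<bar>d\<bar>) * spectral_norm (matrix_inv \<P>)))"
proof -
  define N where "N = spectral_norm (matrix_inv \<P>)"
  define f where "f i = norm (\<Phi>h i - \<Phi> i)" for i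
  have d: "d > 0" using cd by simp
  \<comment> \<open>The start vector is fixed by \<open>T\<close>, so both methods start from the
    same point; in the residual difference \<open>b\<close> cancels.\<close>
  have xh_start: "xh 0 = x 0"
    and rh_eq: "\<And>i. rh i - r i = Er i - (matrix_inv \<P> ** \<A>) *v (xh i - x i)"
    using std chebT low res unfolding chebyshev_method_def chebyshevT_method_def
    by (simp_all add: matrix_vector_mult_diff_distrib flip: matrix_vector_mul_assoc)
  have rh_err: "norm (rh i - r i) \<le> \<sigma> * e i + \<epsilon> * N" for i
    using norm_triangle_ineq4[of "Er i" "(matrix_inv \<P> ** \<A>) *v (xh i - x i)"]
      norm_matrix_vector_mult_le_spectral_norm[of "matrix_inv \<P> ** \<A>" "xh i - x i"] res_err[of i]
    unfolding rh_eq \<sigma>_def e_def N_def by linarith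
  have e0: "e 0 = 0" using xh_start e_def by simp
  \<comment> \<open>The initial update is not truncated and \<open>e 0\<close> vanishes, so only the
    error of the computed residual remains.\<close>
  have f0: "f 0 \<le> \<epsilon> * N / d"
  proof -
    have "\<Phi>h 0 - \<Phi> 0 = (1 / d) *\<^sub>R (rh 0 - r 0)"
      using std chebT unfolding chebyshev_method_def chebyshevT_method_def
      by (simp add: scaleR_diff_right)
    then have "f 0 = norm (rh 0 - r 0) / d" using d by (simp add: f_def)
    then show ?thesis using rh_err[of 0] e0 d by (simp add: divide_right_mono)
  qed
  have f_step: "f (Suc n) \<le> \<epsilon> + \<bar>\<alpha> (Suc n)\<bar> * (\<sigma> * e (Suc n) + \<epsilon> * N) + \<bar>\<beta> (Suc n)\<bar> * f n"
    for n
  proof -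
    \<comment> \<open>The update before truncation: its distance to the exact update is linear in
      the earlier errors, and applying \<open>T\<close> adds one \<epsilon>.\<close>
    let ?y = "\<alpha> (Suc n) *\<^sub>R rh (Suc n) + \<beta> (Suc n) *\<^sub>R \<Phi>h n"
    have eqs: "\<Phi>h (Suc n) = T ?y" "\<Phi> (Suc n) = \<alpha> (Suc n) *\<^sub>R r (Suc n) + \<beta> (Suc n) *\<^sub>R \<Phi> n"
      using std chebT unfolding chebyshev_method_def chebyshevT_method_def \<alpha>_def \<beta>_def
      by simp_all
    have "?y - \<Phi> (Suc n) = \<alpha> (Suc n) *\<^sub>R (rh (Suc n) - r (Suc n)) + \<beta> (Suc n) *\<^sub>R (\<Phi>h n - \<Phi> n)"
      by (simp add: eqs(2) algebra_simps)
    then have "norm (?y - \<Phi> (Suc n))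
        \<le> \<bar>\<alpha> (Suc n)\<bar> * norm (rh (Suc n) - r (Suc n)) + \<bar>\<beta> (Suc n)\<bar> * f n"
      unfolding f_def
      by (metis norm_scaleR norm_triangle_ineq)
    moreover have "\<bar>\<alpha> (Suc n)\<bar> * norm (rh (Suc n) - r (Suc n))
        \<le> \<bar>\<alpha> (Suc n)\<bar> * (\<sigma> * e (Suc n) + \<epsilon> * N)"
      using rh_err by (simp add: mult_left_mono)
    ultimately show ?thesis
      using has_accuracy_norm_diff_le[OF acc, of ?y "\<Phi> (Suc n)"] eqs(1) by (simp add: f_def)
  qed
  have e_step: "e (Suc n) \<le> e n + f n + \<epsilon>" for n
  proof -
    have eqs: "xh (Suc n) = T (xh n + \<Phi>h n)" "x (Suc n) = x n + \<Phi> n"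
      using std chebT unfolding chebyshev_method_def chebyshevT_method_def by simp_all
    have "norm (xh n + \<Phi>h n - x (Suc n)) \<le> e n + f n"
      unfolding e_def f_def eqs(2) add_diff_add by (rule norm_triangle_ineq)
    then show ?thesis
      using has_accuracy_norm_diff_le[OF acc, of "xh n + \<Phi>h n" "x (Suc n)"] eqs(1) e_def by simp
  qed
  have e1: "e 1 \<le> \<epsilon> * (1 + 1 / \<bar>d\<bar> * N)"
    using e_step[of 0] e0 f0 d by (simp add: algebra_simps)
  \<comment> \<open>This makes the coefficient of \<open>e 1\<close> nonnegative, so that the bound
    on \<open>e 1\<close> can be inserted into the one for \<open>e 2\<close>.\<close>
  have \<sigma>_nonneg: "0 \<le> \<sigma>"
    unfolding \<sigma>_def spectral_norm_def by (rule onorm_pos_le) (rule matrix_vector_mul_bounded_linear)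
  have e2: "e 2 \<le> \<epsilon> * (3 + \<bar>\<alpha> 1\<bar> * \<sigma>
      + (\<bar>\<alpha> 1\<bar> + (1 + \<bar>\<beta> 1\<bar> + \<bar>\<alpha> 1\<bar> * \<sigma>) / \<bar>d\<bar>) * N)"
  proof -
    have "e 2 \<le> (1 + \<bar>\<alpha> 1\<bar> * \<sigma>) * e 1 + 2 * \<epsilon> + \<bar>\<alpha> 1\<bar> * \<epsilon> * N + \<bar>\<beta> 1\<bar> * f 0"
      using e_step[of 1] f_step[of 0] by (simp add: algebra_simps eval_nat_numeral)
    also have "\<dots> \<le> (1 + \<bar>\<alpha> 1\<bar> * \<sigma>) * (\<epsilon> * (1 + 1 / \<bar>d\<bar> * N)) + 2 * \<epsilon> + \<bar>\<alpha> 1\<bar> * \<epsilon> * N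
        + \<bar>\<beta> 1\<bar> * (\<epsilon> * N / d)"
      by (rule add_mono[OF add_right_mono[OF add_right_mono[OF mult_left_mono[OF e1]]]
            mult_left_mono[OF f0]]) (use \<sigma>_nonneg in simp_all)
    also have "\<dots> = \<epsilon> * (3 + \<bar>\<alpha> 1\<bar> * \<sigma>
        + (\<bar>\<alpha> 1\<bar> + (1 + \<bar>\<beta> 1\<bar> + \<bar>\<alpha> 1\<bar> * \<sigma>) / \<bar>d\<bar>) * N)"
      using d by (simp add: divide_inverse algebra_simps)
    finally show ?thesis .
  qed
  have e_ge3: "e l \<le> (1 + \<bar>\<alpha> (l - 1)\<bar> * \<sigma>) * e (l - 1)
      + (\<Sum>j=1..l-2. \<bar>\<alpha> j\<bar> * e j * \<sigma> * (\<Prod>i=1..l-j-1. \<bar>\<beta> (i + j)\<bar>))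
      + \<epsilon> * (2 + (\<Sum>j=1..l-2. \<Prod>i=1..l-j-1. \<bar>\<beta> (i + j)\<bar>)
          + ((\<Sum>j=1..l-1. \<bar>\<alpha> j\<bar> * (\<Prod>i=1..l-j-1. \<bar>\<beta> (i + j)\<bar>))
             + (\<Prod>j=1..l-1. \<bar>\<beta> j\<bar>) / \<bar>d\<bar>) * N)"
    if "l \<ge> 3" for l
  proof -
    \<comment> \<open>With this shift the sums up to \<open>l - 2\<close> and \<open>l - 1\<close>
      end at \<open>n\<close> and \<open>Suc n\<close>, free of natural subtraction.\<close>
    define n where "n = l - 2"
    have l: "l = Suc (Suc n)" using \<open>l \<ge> 3\<close> by (simp add: n_def)
    define B where "B j = (\<Prod>i=1..l-j-1. \<bar>\<beta> (i + j)\<bar>)" for j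
    define C where "C = (\<Prod>j=1..Suc n. \<bar>\<beta> j\<bar>)"
    \<comment> \<open>The product is empty at \<open>j = l - 1\<close>. Splitting off this index
      puts its \<sigma> term into the factor of \<open>e (l - 1)\<close>, and its \<epsilon> joins
      the one from \<open>e_step\<close> to give the constant 2.\<close>
    have B_last: "B (Suc n) = 1" by (simp add: B_def l)
    have "f (Suc n) \<le> (\<Sum>j=1..Suc n. (\<epsilon> + \<bar>\<alpha> j\<bar> * (\<sigma> * e j + \<epsilon> * N)) * B j) + C * f 0"
      using linear_recurrence_le[of f "\<lambda>j. \<epsilon> + \<bar>\<alpha> j\<bar> * (\<sigma> * e j + \<epsilon> * N)" "\<lambda>j. \<bar>\<beta> j\<bar>" "Suc n"] f_step
      by (simp add: B_def C_def l)
    also have "C * f 0 \<le> C * (\<epsilon> * N / d)"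
      by (intro mult_left_mono f0) (simp add: C_def prod_nonneg)
    finally have f_le: "f (Suc n) \<le> (\<Sum>j=1..Suc n. (\<epsilon> + \<bar>\<alpha> j\<bar> * (\<sigma> * e j + \<epsilon> * N)) * B j)
        + C * (\<epsilon> * N / d)" by simp
    have split: "(\<Sum>j=1..Suc n. (\<epsilon> + \<bar>\<alpha> j\<bar> * (\<sigma> * e j + \<epsilon> * N)) * B j)
        = \<epsilon> * (\<Sum>j=1..Suc n. B j) + (\<Sum>j=1..Suc n. \<bar>\<alpha> j\<bar> * e j * \<sigma> * B j)
          + \<epsilon> * N * (\<Sum>j=1..Suc n. \<bar>\<alpha> j\<bar> * B j)"
      unfolding sum_distrib_left sum.distrib[symmetric]
      by (rule sum.cong) (simp_all add: algebra_simps)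
    have "e l \<le> e (Suc n) + f (Suc n) + \<epsilon>" unfolding l by (rule e_step)
    also have "\<dots> \<le> e (Suc n) + (\<epsilon> * (\<Sum>j=1..Suc n. B j) + (\<Sum>j=1..Suc n. \<bar>\<alpha> j\<bar> * e j * \<sigma> * B j)
          + \<epsilon> * N * (\<Sum>j=1..Suc n. \<bar>\<alpha> j\<bar> * B j) + C * (\<epsilon> * N / d)) + \<epsilon>"
      using f_le split by simp
    also have "\<dots> = (1 + \<bar>\<alpha> (Suc n)\<bar> * \<sigma>) * e (Suc n) + (\<Sum>j=1..n. \<bar>\<alpha> j\<bar> * e j * \<sigma> * B j)
        + \<epsilon> * (2 + (\<Sum>j=1..n. B j) + ((\<Sum>j=1..Suc n. \<bar>\<alpha> j\<bar> * B j) + C / \<bar>d\<bar>) * N)"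
      using d by (simp add: B_last algebra_simps)
    finally show ?thesis unfolding B_def C_def by (simp add: l)
  qed
  show ?thesis using e1 e2 e_ge3 unfolding N_def by blast
qed

end
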